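(* Let $\mathcal{A}$ be a finite alphabet and $F:\mathcal{A}^{\mathbb{Z}}\to\mathcal{A}^{\mathbb{Z}}$ a cellular automaton. If $\mu\in\mathcal{M}_\sigma(\mathcal{A}^{\mathbb{Z}})$ is a computable measure and $F_*^t\mu\to\nu$ as $t\to\infty$, then $\nu$ is limit-computable.
   Context: $\mathcal{A}^{\mathbb{Z}}$ carries the product topology, $\mathcal{A}^{*}$ is the set of finite words, $\sigma(x)_i=x_{i+1}$ is the shift, and for a word $u$, $[u]=\{x: x_0\cdots x_{|u|-1}=u\}$. $\mathcal{M}_\sigma(\mathcal{A}^{\mathbb{Z}})$ is the set of $\sigma$-invariant Borel probability measures with the weak$^*$ topology. A cellular automaton is a continuous map $F:\mathcal{A}^{\mathbb{Z}}\to\mathcal{A}^{\mathbb{Z}}$ commuting with $\sigma$; $F_*\mu(E)=\mu(F^{-1}(E))$. A measure $\mu\in\mathcal{M}_\sigma(\mathcal{A}^{\mathbb{Z}})$ is computable if there is a computable $f:\mathcal{A}^*\times\mathbb{N}\to\mathbb{Q}$ with $|\mu([u])-f(u,n)|<2^{-n}$ for all $u\in\mathcal{A}^*$, $n\in\mathbb{N}$. A sequence $(\mu_i)_{i\in\mathbb{N}}$ is a uniformly computable sequence of computable measures if there is a computable $f:\mathcal{A}^*\times\mathbb{N}\times\mathbb{N}\to\mathbb{Q}$ with $|\mu_i([u])-f(u,n,i)|<2^{-n}$ for all $u,n,i$. A measure $\nu\in\mathcal{M}_\sigma(\mathcal{A}^{\mathbb{Z}})$ is limit-computable if there is a uniformly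 computable sequence of computable measures $(\mu_i)$ with $\mu_i\to\nu$ (weak$^*$). *)

theory Defs
  imports "HOL-Probability.Probability_Measure" "HOL-Library.Countable"
begin

section \<open>Partial recursive functions\<close>

text \<open>
  Programs carry no arity: \<open>rec_eval p xs y\<close> says that \<open>p\<close> halts on the argument tuple \<open>xs\<close>
  with output \<open>y\<close>; where the length of \<open>xs\<close> does not fit \<open>p\<close>, there is no output. Primitive
  recursion and unbounded search act on the first argument.
\<close>

datatype recf =
    Zero
  | Succ
  | Proj nat
  | Comp recf "recf list"
  | PrimRec recf recf
  | Search recf

inductive rec_eval :: "recf \<Rightarrow> nat list \<Rightarrow> nat \<Rightarrow> bool" where
  zero: "rec_eval Zero xs 0"
| succ: "rec_eval Succ [x] (Suc x)"
| proj: "i < length xs \<Longrightarrow> rec_eval (Proj i) xs (xs ! i)"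
| comp: "list_all2 (\<lambda>q y. rec_eval q xs y) qs ys \<Longrightarrow> rec_eval p ys z
    \<Longrightarrow> rec_eval (Comp p qs) xs z"
| primrec_0: "rec_eval p xs y \<Longrightarrow> rec_eval (PrimRec p q) (0 # xs) y"
| primrec_Suc: "rec_eval (PrimRec p q) (m # xs) y \<Longrightarrow> rec_eval q (m # y # xs) z
    \<Longrightarrow> rec_eval (PrimRec p q) (Suc m # xs) z"
| search: "rec_eval p (m # xs) 0 \<Longrightarrow> (\<And>k. k < m \<Longrightarrow> \<exists>y. rec_eval p (k # xs) (Suc y))
    \<Longrightarrow> rec_eval (Search p) xs m"

lemma rec_eval_unique: "rec_eval p xs y \<Longrightarrow> rec_eval p xs z \<Longrightarrow> y = z"
proof (induction arbitrary: z rule: rec_eval.induct)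
  case (zero xs)
  then show ?case by cases auto
next
  case (succ x)
  then show ?case by cases auto
next
  case (proj i xs)
  from proj(2) show ?case by cases auto
next
  case (comp xs qs ys p w)
  from comp.prems obtain ys' where ys': "list_all2 (\<lambda>q y. rec_eval q xs y) qs ys'"
    and z: "rec_eval p ys' z"
    by cases
  have "ys = ys'"
  proof (rule nth_equalityI)
    show "length ys = length ys'"
      using list_all2_lengthD[OF comp.IH(1)] list_all2_lengthD[OF ys'] by simp
    fix i
    assume i: "i < length ys"
    then have "\<forall>v. rec_eval (qs ! i) xs v \<longrightarrow> ys ! i = v"
      using list_all2_nthD2[OF comp.IH(1)] by blast
    moreover have "rec_eval (qs ! i) xs (ys' ! i)"
      using list_all2_nthD[OF ys'] list_all2_lengthD[OF comp.IH(1)] i by simp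
    ultimately show "ys ! i = ys' ! i" by blast
  qed
  then show ?case using comp.IH(2) z by blast
next
  case (primrec_0 p xs y q)
  from primrec_0.prems have "rec_eval p xs z" by cases
  then show ?case by (rule primrec_0.IH)
next
  case (primrec_Suc p q m xs y w)
  from primrec_Suc.prems obtain y' where "rec_eval (PrimRec p q) (m # xs) y'"
    and z: "rec_eval q (m # y' # xs) z"
    by cases
  then have "y = y'" by (intro primrec_Suc.IH(1))
  then show ?case using primrec_Suc.IH(2) z by simp
next
  case (search p m xs)
  from search.prems have "rec_eval p (z # xs) 0 \<and> (\<forall>k<z. \<exists>y. rec_eval p (k # xs) (Suc y))"
    by cases simp
  then have z: "rec_eval p (z # xs) 0"
    and below: "\<forall>k<z. \<exists>y. rec_eval p (k # xs) (Suc y)"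
    by simp_all
  show ?case
  proof (cases m z rule: linorder_cases)
    case equal
    then show ?thesis .
  next
    case less
    then obtain y where "rec_eval p (m # xs) (Suc y)" using below by blast
    then have "0 = Suc y" by (rule search.IH(1))
    then show ?thesis by simp
  next
    case greater
    then obtain y where "\<forall>v. rec_eval p (z # xs) v \<longrightarrow> Suc y = v" using search.IH(2) by blast
    then have "Suc y = 0" using z by blast
    then show ?thesis by simp
  qed
qed

text \<open>
  A word is coded by the list of the codes of its letters. The injection \<^const>\<open>to_nat\<close> on letters
  is arbitrary, but on a finite alphabet any two choices differ by a finite table, so
  computability does not depend on it. Rationals are represented by their names under the
  surjection \<^const>\<open>nat_to_rat_surj\<close>, which is not injective: a program may return any name of
  the value.
\<close>

definition word_code :: "'a::finite list \<Rightarrow> nat" where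
  "word_code u = list_encode (map to_nat u)"

definition computable_word_nat :: "('a::finite list \<Rightarrow> nat \<Rightarrow> rat) \<Rightarrow> bool" where
  "computable_word_nat f \<longleftrightarrow>
     (\<exists>p. \<forall>u n. \<exists>c. rec_eval p [word_code u, n] c \<and> nat_to_rat_surj c = f u n)"

definition computable_word_nat_nat :: "('a::finite list \<Rightarrow> nat \<Rightarrow> nat \<Rightarrow> rat) \<Rightarrow> bool" where
  "computable_word_nat_nat f \<longleftrightarrow>
     (\<exists>p. \<forall>u n i. \<exists>c. rec_eval p [word_code u, n, i] c \<and> nat_to_rat_surj c = f u n i)"


section \<open>Configurations, cellular automata and invariant measures\<close>

text \<open>
  The type class constraint makes the alphabet a finite discrete space, so the topology of
  \<open>int \<Rightarrow> 'a\<close> is the product of discrete topologies and \<^const>\<open>borel\<close> is its Borel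
  sigma-algebra.
\<close>

definition shift_map :: "(int \<Rightarrow> 'a) \<Rightarrow> int \<Rightarrow> 'a" where
  "shift_map x = (\<lambda>i. x (i + 1))"

definition cylinder :: "'a list \<Rightarrow> (int \<Rightarrow> 'a) set" where
  "cylinder u = {x. \<forall>i<length u. x (int i) = u ! i}"

definition cellular_automaton ::
    "((int \<Rightarrow> 'a::{finite, discrete_topology}) \<Rightarrow> (int \<Rightarrow> 'a)) \<Rightarrow> bool" where
  "cellular_automaton F \<longleftrightarrow> continuous_on UNIV F \<and> F \<circ> shift_map = shift_map \<circ> F"

definition pushforward ::
    "((int \<Rightarrow> 'a::{finite, discrete_topology}) \<Rightarrow> (int \<Rightarrow> 'a)) \<Rightarrow>
     (int \<Rightarrow> 'a) measure \<Rightarrow> (int \<Rightarrow> 'a) measure" where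
  "pushforward F \<mu> = distr \<mu> borel F"

definition invariant_measures :: "(int \<Rightarrow> 'a::{finite, discrete_topology}) measure set" where
  "invariant_measures =
     {\<mu>. prob_space \<mu> \<and> sets \<mu> = sets borel \<and> pushforward shift_map \<mu> = \<mu>}"

text \<open>Continuous real functions are automatically bounded here, the space being compact.\<close>

definition weak_star_tendsto ::
    "(nat \<Rightarrow> (int \<Rightarrow> 'a::{finite, discrete_topology}) measure) \<Rightarrow>
     (int \<Rightarrow> 'a) measure \<Rightarrow> bool" where
  "weak_star_tendsto \<mu>s \<nu> \<longleftrightarrow>
     (\<forall>g::(int \<Rightarrow> 'a) \<Rightarrow> real. continuous_on UNIV g \<longrightarrow>
        (\<lambda>i. \<integral>x. g x \<partial>\<mu>s i) \<longlonglongrightarrow> (\<integral>x. g x \<partial>\<nu>))"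


section \<open>Computable and limit-computable measures\<close>

definition computable_measure ::
    "(int \<Rightarrow> 'a::{finite, discrete_topology}) measure \<Rightarrow> bool" where
  "computable_measure \<mu> \<longleftrightarrow> \<mu> \<in> invariant_measures \<and>
     (\<exists>f. computable_word_nat f \<and>
        (\<forall>u n. \<bar>measure \<mu> (cylinder u) - real_of_rat (f u n)\<bar> < 1 / 2 ^ n))"

definition uniformly_computable ::
    "(nat \<Rightarrow> (int \<Rightarrow> 'a::{finite, discrete_topology}) measure) \<Rightarrow> bool" where
  "uniformly_computable \<mu>s \<longleftrightarrow> (\<forall>i. \<mu>s i \<in> invariant_measures) \<and>
     (\<exists>f. computable_word_nat_nat f \<and>
        (\<forall>u n i. \<bar>measure (\<mu>s i) (cylinder u) - real_of_rat (f u n i)\<bar> < 1 / 2 ^ n))"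

definition limit_computable ::
    "(int \<Rightarrow> 'a::{finite, discrete_topology}) measure \<Rightarrow> bool" where
  "limit_computable \<nu> \<longleftrightarrow> \<nu> \<in> invariant_measures \<and>
     (\<exists>\<mu>s. uniformly_computable \<mu>s \<and> weak_star_tendsto \<mu>s \<nu>)"

end

theory Submission
  imports Defs
begin

text \<open>
  The iterates \<open>F\<^sub>*\<^sup>t \<mu>\<close> themselves form a uniformly computable sequence. On invariant measures \<open>F\<close> may
  be replaced by \<open>G = \<sigma>\<^sup>r \<circ> F\<close>, whose local rule reads only a window \<open>x\<^sub>0 \<dots> x\<^bsub>d-1\<^esub>\<close> to the right.
  Then the first \<open>l\<close> letters of \<open>G\<^sup>t x\<close> depend only on the first \<open>L = l + t d\<close> letters of \<open>x\<close>, so the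
  measure of a cylinder of length \<open>l\<close> under \<open>F\<^sub>*\<^sup>t \<mu>\<close> is a finite sum of \<open>\<mu>\<close>-measures of cylinders of
  length \<open>L\<close>. A program enumerates the words of length \<open>L\<close> as numbers below \<open>|A|\<^sup>L\<close>, simulates \<open>G\<close> on
  their digits, and adds the approximate measures of the words that are mapped to the given one,
  rounded to dyadic rationals with a common denominator.
\<close>

section \<open>Closure properties of total recursive functions\<close>

text \<open>Programs carry no arity, so \<open>k\<close> fixes it here. Only tuples of length
  \<open>k\<close> are constrained, hence junk values of \<open>!\<close> and \<open>drop\<close> on
  other tuples do no harm.\<close>

definition computable_fun :: "nat \<Rightarrow> (nat list \<Rightarrow> nat) \<Rightarrow> bool" where
  "computable_fun k f \<longleftrightarrow> (\<exists>p. \<forall>xs. length xs = k \<longrightarrow> rec_eval p xs (f xs))"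

named_theorems computable_intros

lemma computable_fun_cong:
  assumes "computable_fun k f" and "\<And>xs. length xs = k \<Longrightarrow> f xs = g xs"
  shows "computable_fun k g"
  using assms unfolding computable_fun_def by metis

lemma computable_fun_comp:
  assumes "computable_fun (length gs) f" and "\<And>g. g \<in> set gs \<Longrightarrow> computable_fun k g"
  shows "computable_fun k (\<lambda>xs. f (map (\<lambda>g. g xs) gs))"
proof -
  obtain p where p: "\<And>xs. length xs = length gs \<Longrightarrow> rec_eval p xs (f xs)"
    using assms(1) unfolding computable_fun_def by blast
  obtain q where q: "\<And>g xs. g \<in> set gs \<Longrightarrow> length xs = k \<Longrightarrow> rec_eval (q g) xs (g xs)"
    using assms(2) unfolding computable_fun_def by metis
  have "rec_eval (Comp p (map q gs)) xs (f (map (\<lambda>g. g xs) gs))" if "length xs = k" for xs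
    by (rule rec_eval.comp[OF _ p]) (auto simp: list_all2_conv_all_nth q that)
  then show ?thesis unfolding computable_fun_def by blast
qed

text \<open>Serves the program that witnesses computability of the measure: it is known to halt only
  when its first argument codes a word, so \<open>computable_fun_comp\<close> does not apply to
  it.\<close>

lemma computable_fun_program2:
  assumes "computable_fun k a" and "computable_fun k b"
    and "\<And>xs. length xs = k \<Longrightarrow> rec_eval p [a xs, b xs] (f xs)"
  shows "computable_fun k f"
proof -
  obtain q r where "\<And>xs. length xs = k \<Longrightarrow> rec_eval q xs (a xs)"
    and "\<And>xs. length xs = k \<Longrightarrow> rec_eval r xs (b xs)"
    using assms(1,2) unfolding computable_fun_def by blast
  then have "rec_eval (Comp p [q, r]) xs (f xs)" if "length xs = k" for xs
    by (intro rec_eval.comp[OF _ assms(3)[OF that]]) (auto simp: that)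
  then show ?thesis unfolding computable_fun_def by blast
qed

lemma computable_fun_nth [computable_intros]: "i < k \<Longrightarrow> computable_fun k (\<lambda>xs. xs ! i)"
  unfolding computable_fun_def by (auto intro!: exI[of _ "Proj i"] rec_eval.proj)

lemma computable_fun_drop_nth [computable_intros]:
  "n + i < k \<Longrightarrow> computable_fun k (\<lambda>xs. drop n xs ! i)"
  by (rule computable_fun_cong[OF computable_fun_nth[of "n + i"]]) auto

text \<open>Recursion and search prepend their own variables to the argument tuple. This weakening
  carries functions of the original tuple under such binders.\<close>

lemma computable_fun_drop:
  assumes "computable_fun k a"
  shows "computable_fun (k + n) (\<lambda>xs. a (drop n xs))"
proof (rule computable_fun_cong)
  let ?gs = "map (\<lambda>i xs. xs ! (n + i)) [0..<k]"
  show "computable_fun (k + n) (\<lambda>xs. a (map (\<lambda>g. g xs) ?gs))"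
    by (rule computable_fun_comp) (auto simp: assms intro: computable_intros)
  show "a (map (\<lambda>g. g xs) ?gs) = a (drop n xs)" if "length xs = k + n" for xs
    by (rule arg_cong[where f = a], rule nth_equalityI) (auto simp: that)
qed

lemma computable_fun_Suc [computable_intros]:
  assumes "computable_fun k a"
  shows "computable_fun k (\<lambda>xs. Suc (a xs))"
proof -
  have "computable_fun 1 (\<lambda>xs. Suc (xs ! 0))"
    unfolding computable_fun_def
    by (auto intro!: exI[of _ Succ] rec_eval.succ simp: length_Suc_conv)
  then have "computable_fun (length [a]) (\<lambda>xs. Suc (xs ! 0))" by simp
  from computable_fun_comp[OF this, of k] assms show ?thesis by simp
qed

lemma computable_fun_const [computable_intros]: "computable_fun k (\<lambda>xs. c)"
proof (induction c)
  case 0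
  then show ?case unfolding computable_fun_def by (auto intro: rec_eval.zero)
next
  case (Suc c)
  then show ?case by (rule computable_fun_Suc)
qed

lemma computable_fun_rec:
  assumes n: "computable_fun k n" and b: "computable_fun k b"
    and s: "computable_fun (k + 2) (\<lambda>zs. s (zs ! 0) (zs ! 1) (drop 2 zs))"
  shows "computable_fun k (\<lambda>xs. rec_nat (b xs) (\<lambda>m y. s m y xs) (n xs))"
proof -
  let ?f = "\<lambda>m xs. rec_nat (b xs) (\<lambda>m y. s m y xs) m"
  obtain p where p: "\<And>xs. length xs = k \<Longrightarrow> rec_eval p xs (b xs)"
    using b unfolding computable_fun_def by blast
  obtain q where q: "\<And>zs. length zs = k + 2 \<Longrightarrow> rec_eval q zs (s (zs ! 0) (zs ! 1) (drop 2 zs))"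
    using s unfolding computable_fun_def by blast
  have rec: "rec_eval (PrimRec p q) (m # xs) (?f m xs)" if xs: "length xs = k" for m xs
  proof (induction m)
    case 0
    show ?case using rec_eval.primrec_0[OF p[OF xs]] by simp
  next
    case (Suc m)
    have "rec_eval q (m # ?f m xs # xs) (s m (?f m xs) xs)"
      using q[of "m # ?f m xs # xs"] xs by simp
    from rec_eval.primrec_Suc[OF Suc this] show ?case by simp
  qed
  \<comment> \<open>\<open>PrimRec\<close> expects the counter in front of the parameters:
    \<open>n\<close> supplies it, and the projections copy the whole tuple behind it.\<close>
  let ?gs = "n # map (\<lambda>i xs. xs ! i) [0..<k]"
  have "computable_fun (length ?gs) (\<lambda>zs. ?f (hd zs) (tl zs))"
    unfolding computable_fun_def using rec
    by (intro exI[of _ "PrimRec p q"]) (auto simp: length_Suc_conv)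
  then have "computable_fun k (\<lambda>xs. ?f (hd (map (\<lambda>g. g xs) ?gs)) (tl (map (\<lambda>g. g xs) ?gs)))"
    by (rule computable_fun_comp) (auto simp: n intro: computable_intros)
  then show ?thesis
  proof (rule computable_fun_cong)
    fix xs :: "nat list"
    assume "length xs = k"
    then have "map (\<lambda>g. g xs) (map (\<lambda>i xs. xs ! i) [0..<k]) = xs"
      by (auto simp: o_def map_nth)
    then show "?f (hd (map (\<lambda>g. g xs) ?gs)) (tl (map (\<lambda>g. g xs) ?gs)) = ?f (n xs) xs" by simp
  qed
qed

text \<open>The two assumptions on \<open>f\<close> say that \<open>f xs\<close> is the least zero
  of \<open>P\<close>, exactly what \<open>Search\<close> returns. Division, inversion of the
  pairing and list length are obtained in this way.\<close>

lemma computable_fun_search: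
  assumes P: "computable_fun (k + 1) (\<lambda>zs. P (zs ! 0) (drop 1 zs))"
    and "\<And>xs. length xs = k \<Longrightarrow> P (f xs) xs = 0"
    and "\<And>xs m. length xs = k \<Longrightarrow> m < f xs \<Longrightarrow> P m xs \<noteq> 0"
  shows "computable_fun k f"
proof -
  obtain p where p: "\<And>zs. length zs = k + 1 \<Longrightarrow> rec_eval p zs (P (zs ! 0) (drop 1 zs))"
    using P unfolding computable_fun_def by blast
  have eval: "rec_eval p (m # xs) (P m xs)" if "length xs = k" for m xs
    using p[of "m # xs"] that by simp
  have "rec_eval (Search p) xs (f xs)" if "length xs = k" for xs
  proof (rule rec_eval.search)
    show "rec_eval p (f xs # xs) 0" using eval[OF that, of "f xs"] assms(2)[OF that] by simp
    show "\<exists>y. rec_eval p (m # xs) (Suc y)" if "m < f xs" for m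
      using eval[of xs m] assms(3)[of xs m] that \<open>length xs = k\<close> by (metis not0_implies_Suc)
  qed
  then show ?thesis unfolding computable_fun_def by blast
qed

section \<open>Arithmetic, case distinction, bounded sums and finite tables\<close>

lemma computable_fun_add [computable_intros]:
  assumes "computable_fun k a" and "computable_fun k b"
  shows "computable_fun k (\<lambda>xs. a xs + b xs)"
proof (rule computable_fun_cong)
  show "computable_fun k (\<lambda>xs. rec_nat (b xs) (\<lambda>m y. Suc y) (a xs))"
    by (intro computable_fun_rec computable_intros assms) simp
  have "rec_nat c (\<lambda>m y. Suc y) n = n + c" for c n :: nat by (induction n) simp_all
  then show "rec_nat (b xs) (\<lambda>m y. Suc y) (a xs) = a xs + b xs" for xs .
qed

lemma computable_fun_mult [computable_intros]:
  assumes "computable_fun k a" and "computable_fun k b"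
  shows "computable_fun k (\<lambda>xs. a xs * b xs)"
proof (rule computable_fun_cong)
  show "computable_fun k (\<lambda>xs. rec_nat 0 (\<lambda>m y. b xs + y) (a xs))"
    by (intro computable_fun_rec computable_intros assms[THEN computable_fun_drop] assms) simp
  have "rec_nat 0 (\<lambda>m y. c + y) n = n * c" for c n :: nat by (induction n) simp_all
  then show "rec_nat 0 (\<lambda>m y. b xs + y) (a xs) = a xs * b xs" for xs .
qed

lemma computable_fun_power [computable_intros]:
  assumes "computable_fun k a" and "computable_fun k b"
  shows "computable_fun k (\<lambda>xs. a xs ^ b xs)"
proof (rule computable_fun_cong)
  show "computable_fun k (\<lambda>xs. rec_nat 1 (\<lambda>m y. a xs * y) (b xs))"
    by (intro computable_fun_rec computable_intros assms[THEN computable_fun_drop] assms) simp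
  have "rec_nat 1 (\<lambda>m y. c * y) n = c ^ n" for c n :: nat by (induction n) simp_all
  then show "rec_nat 1 (\<lambda>m y. a xs * y) (b xs) = a xs ^ b xs" for xs .
qed

lemma computable_fun_diff [computable_intros]:
  assumes "computable_fun k a" and "computable_fun k b"
  shows "computable_fun k (\<lambda>xs. a xs - b xs)"
proof (rule computable_fun_cong)
  \<comment> \<open>The predecessor is a recursion that returns its counter; iterating it gives
    truncated subtraction.\<close>
  have pred: "computable_fun l (\<lambda>xs. c xs - 1)" if "computable_fun l c" for l c
  proof (rule computable_fun_cong)
    show "computable_fun l (\<lambda>xs. rec_nat 0 (\<lambda>m y. m) (c xs))"
      by (intro computable_fun_rec computable_intros that) simp
    show "rec_nat 0 (\<lambda>m y. m) (c xs) = c xs - 1" for xs by (cases "c xs") simp_all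
  qed
  show "computable_fun k (\<lambda>xs. rec_nat (a xs) (\<lambda>m y. y - 1) (b xs))"
    by (intro computable_fun_rec pred computable_intros assms) simp
  have "rec_nat c (\<lambda>m y. y - 1) n = c - n" for c n :: nat by (induction n) simp_all
  then show "rec_nat (a xs) (\<lambda>m y. y - 1) (b xs) = a xs - b xs" for xs .
qed

lemma computable_fun_if_0:
  assumes "computable_fun k a" and "computable_fun k b" and "computable_fun k c"
  shows "computable_fun k (\<lambda>xs. if a xs = 0 then b xs else c xs)"
proof (rule computable_fun_cong)
  show "computable_fun k (\<lambda>xs. rec_nat (b xs) (\<lambda>m y. c xs) (a xs))"
    by (intro computable_fun_rec assms[THEN computable_fun_drop] assms)
  show "rec_nat (b xs) (\<lambda>m y. c xs) (a xs) = (if a xs = 0 then b xs else c xs)" for xs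
    by (cases "a xs") simp_all
qed

lemma computable_fun_if_eq [computable_intros]:
  assumes "computable_fun k a" and "computable_fun k b"
    and "computable_fun k c" and "computable_fun k d"
  shows "computable_fun k (\<lambda>xs. if a xs = b xs then c xs else d xs)"
proof (rule computable_fun_cong)
  \<comment> \<open>A sum of both truncated differences vanishes exactly in the case of
    equality.\<close>
  let ?e = "\<lambda>xs. (a xs - b xs) + (b xs - a xs)"
  show "computable_fun k (\<lambda>xs. if ?e xs = 0 then c xs else d xs)"
    by (intro computable_fun_if_0 computable_intros assms)
qed auto

lemma computable_fun_div [computable_intros]:
  assumes "computable_fun k a" and "computable_fun k b"
  shows "computable_fun k (\<lambda>xs. a xs div b xs)"
proof (rule computable_fun_search)
  \<comment> \<open>For \<open>b xs > 0\<close> this vanishes iff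
    \<open>a xs < Suc q * b xs\<close>. The first branch makes 0 the least zero when
    \<open>b xs = 0\<close>, in accordance with division by zero.\<close>
  let ?P = "\<lambda>q xs. if b xs = 0 then 0 else Suc (a xs) - Suc q * b xs"
  show "computable_fun (k + 1) (\<lambda>zs. ?P (zs ! 0) (drop 1 zs))"
    by (intro computable_intros assms[THEN computable_fun_drop] assms) simp
  show "?P (a xs div b xs) xs = 0" for xs
    by (simp add: Suc_le_eq dividend_less_div_times)
  show "?P q xs \<noteq> 0" if "q < a xs div b xs" for q xs
  proof -
    have "Suc q * b xs \<le> a xs div b xs * b xs" using that by (intro mult_right_mono) auto
    also have "\<dots> \<le> a xs" by simp
    finally show ?thesis using that by (cases "b xs = 0") auto
  qed
qed

lemma computable_fun_mod [computable_intros]: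
  assumes "computable_fun k a" and "computable_fun k b"
  shows "computable_fun k (\<lambda>xs. a xs mod b xs)"
proof (rule computable_fun_cong)
  show "computable_fun k (\<lambda>xs. a xs - a xs div b xs * b xs)"
    by (intro computable_intros assms)
qed (simp add: minus_div_mult_eq_mod)

lemma computable_fun_sum [computable_intros]:
  assumes "computable_fun k n"
    and g: "computable_fun (k + 1) (\<lambda>zs. g (zs ! 0) (drop 1 zs))"
  shows "computable_fun k (\<lambda>xs. \<Sum>j<n xs. g j xs)"
proof (rule computable_fun_cong)
  \<comment> \<open>A recursion step sees the counter, the accumulator and the parameters; the
    summand must not see the accumulator, so position 1 is skipped.\<close>
  let ?gs = "(\<lambda>zs. zs ! 0) # map (\<lambda>i zs. zs ! (2 + i)) [0..<k]"
  have "computable_fun (length ?gs) (\<lambda>zs. g (zs ! 0) (drop 1 zs))" using g by simp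
  then have "computable_fun (k + 2)
      (\<lambda>zs. g (map (\<lambda>g. g zs) ?gs ! 0) (drop 1 (map (\<lambda>g. g zs) ?gs)))"
    by (rule computable_fun_comp) (auto intro: computable_intros)
  then have "computable_fun (k + 2) (\<lambda>zs. g (zs ! 0) (drop 2 zs))"
  proof (rule computable_fun_cong)
    fix zs :: "nat list"
    assume "length zs = k + 2"
    then have "drop 1 (map (\<lambda>g. g zs) ?gs) = drop 2 zs" by (intro nth_equalityI) auto
    then show "g (map (\<lambda>g. g zs) ?gs ! 0) (drop 1 (map (\<lambda>g. g zs) ?gs)) = g (zs ! 0) (drop 2 zs)"
      by simp
  qed
  then show "computable_fun k (\<lambda>xs. rec_nat 0 (\<lambda>m y. y + g m xs) (n xs))"
    by (intro computable_fun_rec computable_intros assms) simp_all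
  have "rec_nat 0 (\<lambda>m y. y + g m xs) i = (\<Sum>j<i. g j xs)" for i xs by (induction i) simp_all
  then show "rec_nat 0 (\<lambda>m y. y + g m xs) (n xs) = (\<Sum>j<n xs. g j xs)" for xs .
qed

text \<open>\<open>T\<close> is arbitrary: only its values below \<open>N\<close> occur, and a
  nested case distinction lists them one by one. Letters, their codes and the local rule enter
  programs through such tables.\<close>

lemma computable_fun_table_mod:
  assumes "computable_fun k a" and "N > 0"
  shows "computable_fun k (\<lambda>xs. T (a xs mod N))"
proof -
  have "computable_fun k (\<lambda>xs. if a xs mod N < m then T (a xs mod N) else 0)" for m
  proof (induction m)
    case 0
    show ?case by (simp add: computable_fun_const)
  next
    case (Suc m)
    have "computable_fun k (\<lambda>xs. if a xs mod N = m then T m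
        else if a xs mod N < m then T (a xs mod N) else 0)"
      by (intro computable_intros assms Suc.IH)
    then show ?case by (rule computable_fun_cong) auto
  qed
  from this[of N] show ?thesis by (rule computable_fun_cong) (use assms in simp)
qed

section \<open>Computing with codes\<close>

lemma computable_fun_triangle [computable_intros]:
  "computable_fun k a \<Longrightarrow> computable_fun k (\<lambda>xs. triangle (a xs))"
  unfolding triangle_def by (intro computable_intros)

lemma computable_fun_prod_encode [computable_intros]:
  "computable_fun k a \<Longrightarrow> computable_fun k b \<Longrightarrow> computable_fun k (\<lambda>xs. prod_encode (a xs, b xs))"
  unfolding prod_encode_def by (simp, intro computable_intros)

lemma triangle_mono: "m \<le> n \<Longrightarrow> triangle m \<le> triangle n"
  by (induction rule: dec_induct) auto

text \<open>In Cantor's pairing \<open>s\<close> is the number of the diagonal and the first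
  component is the position on it.\<close>

lemma prod_decode_eq_triangle:
  fixes c :: nat
  defines "s \<equiv> fst (prod_decode c) + snd (prod_decode c)"
  shows "c = triangle s + fst (prod_decode c)"
  using prod_decode_inverse[of c] unfolding s_def by (cases "prod_decode c") (simp add: prod_encode_def)

lemma computable_fun_sum_prod_decode:
  assumes "computable_fun k a"
  shows "computable_fun k (\<lambda>xs. fst (prod_decode (a xs)) + snd (prod_decode (a xs)))"
proof (rule computable_fun_search)
  \<comment> \<open>The diagonal of \<open>c\<close> is the least \<open>s\<close> with
    \<open>c < triangle (Suc s)\<close>, since the first component is at most
    \<open>s\<close>.\<close>
  let ?P = "\<lambda>s xs. Suc (a xs) - triangle (Suc s)"
  let ?s = "\<lambda>xs. fst (prod_decode (a xs)) + snd (prod_decode (a xs))"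
  show "computable_fun (k + 1) (\<lambda>zs. ?P (zs ! 0) (drop 1 zs))"
    by (intro computable_intros assms[THEN computable_fun_drop] assms) simp
  show "?P (?s xs) xs = 0" for xs
    using prod_decode_eq_triangle[of "a xs"] by simp
  show "?P s xs \<noteq> 0" if "s < ?s xs" for s xs
  proof -
    have "triangle (Suc s) \<le> triangle (?s xs)" using that by (intro triangle_mono) simp
    then have "triangle (Suc s) \<le> a xs" using prod_decode_eq_triangle[of "a xs"] by linarith
    then show ?thesis by simp
  qed
qed

lemma computable_fun_fst_prod_decode [computable_intros]:
  assumes "computable_fun k a"
  shows "computable_fun k (\<lambda>xs. fst (prod_decode (a xs)))"
proof (rule computable_fun_cong)
  let ?s = "\<lambda>xs. fst (prod_decode (a xs)) + snd (prod_decode (a xs))"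
  show "computable_fun k (\<lambda>xs. a xs - triangle (?s xs))"
    by (intro computable_fun_diff computable_fun_triangle computable_fun_sum_prod_decode assms)
  show "a xs - triangle (?s xs) = fst (prod_decode (a xs))" for xs
    using prod_decode_eq_triangle[of "a xs"] by linarith
qed

lemma computable_fun_snd_prod_decode [computable_intros]:
  assumes "computable_fun k a"
  shows "computable_fun k (\<lambda>xs. snd (prod_decode (a xs)))"
proof (rule computable_fun_cong)
  show "computable_fun k
      (\<lambda>xs. fst (prod_decode (a xs)) + snd (prod_decode (a xs)) - fst (prod_decode (a xs)))"
    by (intro computable_fun_diff computable_fun_sum_prod_decode computable_intros assms)
qed simp

lemma prod_decode_0: "prod_decode 0 = (0, 0)"
  by (simp add: prod_decode_def prod_decode_aux.simps)

lemma computable_fun_length [computable_intros]: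
  assumes "computable_fun k a"
  shows "computable_fun k (\<lambda>xs. length (list_decode (a xs)))"
proof (rule computable_fun_search)
  \<comment> \<open>The code of a nonempty list is the successor of the pair of head and coded tail,
    so one step takes the tail. The code 0 of the empty list is a fixed point because
    \<open>prod_decode 0 = (0, 0)\<close>. The length is the first step that reaches 0.\<close>
  let ?P = "\<lambda>i xs. rec_nat (a xs) (\<lambda>_ c. snd (prod_decode (c - 1))) i"
  have P: "?P i xs = list_encode (drop i (list_decode (a xs)))" for i xs
  proof (induction i)
    case (Suc i)
    then show ?case
      by (cases "drop i (list_decode (a xs))")
        (auto simp: prod_decode_0 drop_Suc simp flip: tl_drop)
  qed simp
  show "computable_fun (k + 1) (\<lambda>zs. ?P (zs ! 0) (drop 1 zs))"
    by (intro computable_fun_rec computable_intros assms[THEN computable_fun_drop] assms) simp_all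
  have "list_encode ys = 0 \<longleftrightarrow> ys = []" for ys by (cases ys) auto
  then show "?P (length (list_decode (a xs))) xs = 0"
    and "i < length (list_decode (a xs)) \<Longrightarrow> ?P i xs \<noteq> 0" for i xs
    unfolding P by simp_all
qed

section \<open>Rational approximations\<close>

text \<open>With denominator 0 both sides are 0, so names of rationals with zero denominator need no
  separate treatment later.\<close>

lemma real_of_rat_Fract: "real_of_rat (Fract a b) = real_of_int a / real_of_int b"
  by (cases "b = 0") (auto simp: of_rat_rat rat_number_collapse)

text \<open>
  With \<open>x\<close> and \<open>y\<close> the codes of numerator and denominator, equal parity means equal signs, and
  the absolute value of the integer with code \<open>x\<close> is \<open>x div 2 + x mod 2\<close>.
\<close>

definition dyadic_floor :: "nat \<Rightarrow> nat \<Rightarrow> nat" where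
  "dyadic_floor c m =
     (if fst (prod_decode c) mod 2 = snd (prod_decode c) mod 2
      then (fst (prod_decode c) div 2 + fst (prod_decode c) mod 2) * 2 ^ m
             div (snd (prod_decode c) div 2 + snd (prod_decode c) mod 2)
      else 0)"

lemma computable_fun_dyadic_floor [computable_intros]:
  "computable_fun k a \<Longrightarrow> computable_fun k b \<Longrightarrow> computable_fun k (\<lambda>xs. dyadic_floor (a xs) (b xs))"
  unfolding dyadic_floor_def by (intro computable_intros)

lemma int_decode_parity:
  "int_decode x = (if even x then 1 else -1) * int (x div 2 + x mod 2)"
  by (cases x rule: parity_cases) (simp_all add: int_decode_def sum_decode_def)

text \<open>For equal signs the quotient is one of natural numbers, and \<open>div\<close> is its
  floor. For unequal signs the value is at most 0, and \<open>nat\<close> truncates the floor to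
  0.\<close>

lemma dyadic_floor:
  "dyadic_floor c m = nat \<lfloor>real_of_rat (nat_to_rat_surj c) * 2 ^ m\<rfloor>"
proof -
  obtain x y where c: "prod_decode c = (x, y)" by (cases "prod_decode c")
  define X Y where "X = x div 2 + x mod 2" and "Y = y div 2 + y mod 2"
  have q: "real_of_rat (nat_to_rat_surj c)
      = ((if even x then 1 else -1) * real X) / ((if even y then 1 else -1) * real Y)"
    by (simp add: nat_to_rat_surj_def c real_of_rat_Fract int_decode_parity X_def Y_def)
  show ?thesis
  proof (cases "even x = even y")
    case True
    then have "real_of_rat (nat_to_rat_surj c) * 2 ^ m = real (X * 2 ^ m) / real Y"
      unfolding q by auto
    moreover have "dyadic_floor c m = X * 2 ^ m div Y"
    proof -
      have "x mod 2 = y mod 2" using True by presburger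
      then show ?thesis by (simp add: dyadic_floor_def c X_def Y_def)
    qed
    ultimately show ?thesis by (simp add: floor_divide_of_nat_eq del: of_nat_mult)
  next
    case False
    then have "real_of_rat (nat_to_rat_surj c) \<le> 0" unfolding q by auto
    then have "real_of_rat (nat_to_rat_surj c) * 2 ^ m \<le> 0"
      by (intro mult_nonpos_nonneg) simp_all
    then have "\<lfloor>real_of_rat (nat_to_rat_surj c) * 2 ^ m\<rfloor> \<le> 0" by linarith
    moreover have "x mod 2 \<noteq> y mod 2" using False by presburger
    then have "dyadic_floor c m = 0" by (simp add: dyadic_floor_def c)
    ultimately show ?thesis by simp
  qed
qed

text \<open>One unit of \<open>1 / 2 ^ m\<close> comes from the approximation and one from rounding;
  truncation at 0 adds nothing because \<open>r\<close> is nonnegative.\<close>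

lemma dyadic_floor_approx:
  assumes "0 \<le> r" and "\<bar>r - real_of_rat (nat_to_rat_surj c)\<bar> < 1 / 2 ^ m"
  shows "\<bar>r - real (dyadic_floor c m) / 2 ^ m\<bar> \<le> 2 / 2 ^ m"
proof -
  define s where "s = real_of_rat (nat_to_rat_surj c) * 2 ^ m"
  have "\<bar>r * 2 ^ m - s\<bar> = \<bar>r - real_of_rat (nat_to_rat_surj c)\<bar> * 2 ^ m"
    by (simp add: s_def abs_mult flip: left_diff_distrib)
  also have "\<dots> < 1" using assms(2) by (simp add: field_simps)
  finally have "\<bar>r * 2 ^ m - s\<bar> < 1" .
  moreover have "0 \<le> r * 2 ^ m" using assms(1) by simp
  moreover have "real (dyadic_floor c m) = max 0 (of_int \<lfloor>s\<rfloor>)"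
    unfolding dyadic_floor s_def[symmetric] by (simp add: max_def)
  ultimately have "\<bar>r * 2 ^ m - real (dyadic_floor c m)\<bar> \<le> 2" by linarith
  then have "\<bar>(r * 2 ^ m - real (dyadic_floor c m)) / 2 ^ m\<bar> \<le> 2 / 2 ^ m"
    by (simp add: abs_divide divide_right_mono)
  then show ?thesis by (simp add: diff_divide_distrib)
qed

text \<open>Even codes decode to nonnegative integers, so doubling turns natural numerators and
  denominators into a name of their quotient.\<close>

lemma nat_to_rat_surj_prod_encode_double:
  "real_of_rat (nat_to_rat_surj (prod_encode (2 * a, 2 * b))) = real a / real b"
  by (simp add: nat_to_rat_surj_def real_of_rat_Fract int_decode_parity)

section \<open>Numbers as configurations\<close>

lemma digit_sum_less:
  fixes K :: nat
  assumes "\<And>i. i < L \<Longrightarrow> a i < K"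
  shows "(\<Sum>i<L. a i * K ^ i) < K ^ L"
  using assms
proof (induction L)
  case (Suc L)
  have "(\<Sum>i<Suc L. a i * K ^ i) < K ^ L + a L * K ^ L" using Suc by simp
  also have "\<dots> = Suc (a L) * K ^ L" by simp
  also have "\<dots> \<le> K * K ^ L" using Suc.prems[of L] by (intro mult_right_mono) auto
  finally show ?case by simp
qed simp

lemma digit_sum_digit:
  fixes K :: nat
  assumes "\<And>i. i < L \<Longrightarrow> a i < K" and "j < L"
  shows "(\<Sum>i<L. a i * K ^ i) div K ^ j mod K = a j"
  using assms
proof (induction L arbitrary: a j)
  case (Suc L)
  have K: "a 0 < K" using Suc.prems(1)[of 0] by simp
  have sum: "(\<Sum>i<Suc L. a i * K ^ i) = a 0 + K * (\<Sum>i<L. a (Suc i) * K ^ i)"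
    unfolding sum.lessThan_Suc_shift by (simp add: sum_distrib_left mult_ac)
  show ?case
  proof (cases j)
    case 0
    then show ?thesis using K unfolding sum by simp
  next
    case (Suc j')
    have "(\<Sum>i<Suc L. a i * K ^ i) div K ^ j = (\<Sum>i<L. a (Suc i) * K ^ i) div K ^ j'"
      using K unfolding sum by (simp add: Suc div_mult2_eq)
    then show ?thesis using Suc.IH[of "\<lambda>i. a (Suc i)" j'] Suc.prems Suc by auto
  qed
qed simp

lemma digit_sum_eq: "(\<Sum>i<L. (w div K ^ i mod K) * K ^ i) = w mod K ^ L" for K :: nat
proof (induction L)
  case (Suc L)
  then show ?case using mod_mult2_eq[of w "K ^ L" K] by (simp add: mult_ac)
qed simp

text \<open>Digits must range over exactly the numbers below \<open>CARD('a)\<close>, whereas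
  \<open>to_nat\<close> is an arbitrary injection that may exceed this bound.\<close>

definition letter :: "nat \<Rightarrow> 'a::finite" where
  "letter = (SOME e. bij_betw e {..<CARD('a)} UNIV)"

lemma bij_betw_letter: "bij_betw (letter :: nat \<Rightarrow> 'a::finite) {..<CARD('a)} UNIV"
proof -
  have "\<exists>e :: nat \<Rightarrow> 'a. bij_betw e {..<CARD('a)} UNIV"
    using ex_bij_betw_nat_finite[of "UNIV :: 'a set"] by (simp add: atLeast0LessThan)
  then show ?thesis unfolding letter_def by (rule someI_ex)
qed

definition letter_index :: "'a::finite \<Rightarrow> nat" where
  "letter_index = inv_into {..<CARD('a)} letter"

lemma letter_letter_index [simp]: "letter (letter_index a) = a"
  unfolding letter_index_def
  using bij_betw_letter[where 'a = 'a] by (simp add: bij_betw_inv_into_right)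

lemma letter_index_letter [simp]: "i < CARD('a) \<Longrightarrow> letter_index (letter i :: 'a::finite) = i"
  unfolding letter_index_def
  using bij_betw_letter[where 'a = 'a] by (simp add: bij_betw_inv_into_left)

lemma letter_index_less: "letter_index (a :: 'a::finite) < CARD('a)"
proof -
  have "letter_index a \<in> {..<CARD('a)}"
    unfolding letter_index_def
    using bij_betw_letter[where 'a = 'a] by (intro inv_into_into) (simp add: bij_betw_def)
  then show ?thesis by simp
qed

text \<open>
  The base-\<open>CARD('a)\<close> digits of \<open>w\<close>, least significant first, give the letters at the positions
  \<open>0, 1, 2, \<dots>\<close>; the letters at negative positions are junk.
\<close>

definition conf :: "nat \<Rightarrow> int \<Rightarrow> 'a::finite" where
  "conf w i = letter (w div CARD('a) ^ nat i mod CARD('a))"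

definition prefix :: "nat \<Rightarrow> (int \<Rightarrow> 'a) \<Rightarrow> 'a list" where
  "prefix L x = map (\<lambda>i. x (int i)) [0..<L]"

lemma length_prefix [simp]: "length (prefix L x) = L"
  by (simp add: prefix_def)

lemma prefix_eq_iff: "prefix L x = prefix L y \<longleftrightarrow> (\<forall>i<L. x (int i) = y (int i))"
  by (auto simp: prefix_def)

lemma cylinder_eq: "cylinder u = {x. prefix (length u) x = u}"
proof -
  have "prefix (length u) x = u \<longleftrightarrow> (\<forall>i<length u. x (int i) = u ! i)" for x
    unfolding list_eq_iff_nth_eq[of "prefix (length u) x"] by (simp add: prefix_def)
  then show ?thesis by (simp add: cylinder_def)
qed

lemma conf_digit_sum:
  assumes "i < L"
  shows "conf (\<Sum>j<L. letter_index (x j) * CARD('a) ^ j) (int i) = (x i :: 'a::finite)"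
  unfolding conf_def using assms by (simp add: digit_sum_digit letter_index_less)

text \<open>By uniqueness of base-\<open>CARD('a)\<close> expansions, the numbers below
  \<open>CARD('a) ^ L\<close> index the cylinders of length \<open>L\<close>: existence gives
  covering, uniqueness gives disjointness.\<close>

lemma ex1_conf_prefix:
  "\<exists>!w. w < CARD('a) ^ L \<and> prefix L (conf w) = prefix L (x :: int \<Rightarrow> 'a::finite)"
proof (rule ex1I)
  let ?w = "\<Sum>j<L. letter_index (x (int j)) * CARD('a) ^ j"
  show "?w < CARD('a) ^ L \<and> prefix L (conf ?w) = prefix L x"
    by (simp add: prefix_eq_iff conf_digit_sum[where x = "\<lambda>j. x (int j)"]
        digit_sum_less letter_index_less)
  fix w
  assume w: "w < CARD('a) ^ L \<and> prefix L (conf w) = prefix L x"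
  \<comment> \<open>As \<open>w < CARD('a) ^ L\<close>, reduction modulo this power does not change
    \<open>w\<close>, so its first \<open>L\<close> digits determine it.\<close>
  then have "w = (\<Sum>i<L. (w div CARD('a) ^ i mod CARD('a)) * CARD('a) ^ i)"
    by (simp add: digit_sum_eq)
  also have "\<dots> = ?w"
  proof (rule sum.cong)
    fix i
    assume "i \<in> {..<L}"
    then have "x (int i) = letter (w div CARD('a) ^ i mod CARD('a))"
      using w by (auto simp: prefix_eq_iff conf_def)
    then show "w div CARD('a) ^ i mod CARD('a) * CARD('a) ^ i
        = letter_index (x (int i)) * CARD('a) ^ i" by simp
  qed simp
  finally show "w = ?w" .
qed

lemma computable_fun_word_code_prefix [computable_intros]:
  assumes "computable_fun k L" and "computable_fun k w"
  shows "computable_fun k (\<lambda>xs. word_code (prefix (L xs) (conf (w xs) :: int \<Rightarrow> 'a::finite)))"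
proof (rule computable_fun_cong)
  let ?K = "CARD('a)"
  let ?c = "\<lambda>xs i. to_nat (letter (w xs div ?K ^ i mod ?K) :: 'a)"
  \<comment> \<open>The list is built from its end: after \<open>n\<close> rounds the value codes
    the last \<open>n\<close> letters of the prefix.\<close>
  let ?f = "\<lambda>n xs. rec_nat 0 (\<lambda>m y. Suc (prod_encode (?c xs (L xs - Suc m), y))) n"
  show "computable_fun k (\<lambda>xs. ?f (L xs) xs)"
    by (intro computable_fun_rec computable_fun_table_mod[where T = "\<lambda>j. to_nat (letter j :: 'a)"]
        computable_intros assms[THEN computable_fun_drop] assms) simp_all
  have f: "?f n xs = list_encode (map (?c xs) [L xs - n..<L xs])" if "n \<le> L xs" for n xs
    using that
  proof (induction n)
    case (Suc n)
    have "[L xs - Suc n..<L xs] = (L xs - Suc n) # [L xs - n..<L xs]"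
      using Suc.prems by (simp add: upt_conv_Cons Suc_diff_Suc)
    then show ?case using Suc by simp
  qed simp
  show "?f (L xs) xs = word_code (prefix (L xs) (conf (w xs) :: int \<Rightarrow> 'a))" for xs
    by (simp add: f word_code_def prefix_def conf_def o_def)
qed

lemma length_list_decode_word_code: "length (list_decode (word_code u)) = length u"
  by (simp add: word_code_def)

lemma word_code_eq_iff: "word_code u = word_code v \<longleftrightarrow> u = v"
  by (simp add: word_code_def list_encode_eq inj_map_eq_map)

section \<open>Simulating a one-sided cellular automaton on numbers\<close>

definition window :: "nat \<Rightarrow> ((int \<Rightarrow> 'a) \<Rightarrow> (int \<Rightarrow> 'a)) \<Rightarrow> bool" where
  "window d G \<longleftrightarrow> G \<circ> shift_map = shift_map \<circ> G \<and>
     (\<forall>x y. prefix d x = prefix d y \<longrightarrow> G x 0 = G y 0)"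

text \<open>\<open>w div CARD('a) ^ i mod CARD('a) ^ d\<close> holds the digits
  \<open>i, ..., i + d - 1\<close>, the window at position \<open>i\<close>. It is below
  \<open>CARD('a) ^ d\<close>, so the local rule becomes a finite table. Positions beyond the top
  digit of \<open>w\<close> read as digit 0.\<close>

definition step :: "((int \<Rightarrow> 'a::finite) \<Rightarrow> (int \<Rightarrow> 'a)) \<Rightarrow> nat \<Rightarrow> nat \<Rightarrow> nat \<Rightarrow> nat" where
  "step G d L w = (\<Sum>i<L. letter_index (G (conf (w div CARD('a) ^ i mod CARD('a) ^ d)) 0) * CARD('a) ^ i)"

lemma shift_map_funpow: "(shift_map ^^ n) x = (\<lambda>i. x (i + int n))"
  by (induction n) (auto simp: shift_map_def algebra_simps)

lemma commute_shift_map_funpow: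
  assumes "G \<circ> shift_map = shift_map \<circ> G"
  shows "G ((shift_map ^^ n) x) = (shift_map ^^ n) (G x)"
proof (induction n)
  case (Suc n)
  then show ?case using fun_cong[OF assms, of "(shift_map ^^ n) x"] by simp
qed simp

lemma window_apply:
  assumes "window d G"
  shows "G x (int i) = G ((shift_map ^^ i) x) 0"
proof -
  have "G ((shift_map ^^ i) x) = (shift_map ^^ i) (G x)"
    using assms by (intro commute_shift_map_funpow) (simp add: window_def)
  then show ?thesis by (simp add: shift_map_funpow[of i "G x"])
qed

lemma digit_mod_power:
  fixes v K :: nat
  assumes "j < d" and "K > 0"
  shows "v mod K ^ d div K ^ j mod K = v div K ^ j mod K"
proof -
  obtain e where "d = Suc (j + e)" using assms by (auto simp: less_iff_Suc_add)
  then have "v mod K ^ d = K ^ j * (v div K ^ j mod (K * K ^ e)) + v mod K ^ j"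
    using mod_mult2_eq[of v "K ^ j" "K * K ^ e"] by (simp add: power_add mult_ac)
  then have "v mod K ^ d div K ^ j = v div K ^ j mod (K * K ^ e)" using assms(2) by simp
  then show ?thesis by (simp add: mod_mod_cancel)
qed

lemma prefix_conf_digits:
  "prefix d (conf (w div CARD('a) ^ i mod CARD('a) ^ d)) = prefix d ((shift_map ^^ i) (conf w :: int \<Rightarrow> 'a::finite))"
proof -
  let ?K = "CARD('a)"
  have "w div ?K ^ i mod ?K ^ d div ?K ^ j mod ?K = w div ?K ^ (j + i) mod ?K" if "j < d" for j
  proof -
    have "w div ?K ^ i mod ?K ^ d div ?K ^ j mod ?K = w div ?K ^ i div ?K ^ j mod ?K"
      using that by (simp add: digit_mod_power)
    also have "w div ?K ^ i div ?K ^ j = w div ?K ^ (j + i)"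
      by (simp add: div_mult2_eq[symmetric] power_add mult.commute)
    finally show ?thesis .
  qed
  then show ?thesis by (simp add: prefix_eq_iff shift_map_funpow conf_def nat_add_distrib)
qed

lemma conf_step:
  assumes "window d G" and "i < L"
  shows "conf (step G d L w) (int i) = G (conf w) (int i)"
proof -
  have "conf (step G d L w) (int i) = G (conf (w div CARD('a) ^ i mod CARD('a) ^ d)) 0"
    unfolding step_def by (rule conf_digit_sum[OF assms(2)])
  also have "\<dots> = G ((shift_map ^^ i) (conf w)) 0"
    using assms(1) prefix_conf_digits unfolding window_def by blast
  also have "\<dots> = G (conf w) (int i)" by (rule window_apply[OF assms(1), symmetric])
  finally show ?thesis .
qed

lemma window_prefix:
  assumes "window d G" and "prefix (l + d) x = prefix (l + d) y"
  shows "prefix l (G x) = prefix l (G y)"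
  unfolding prefix_eq_iff
proof (intro allI impI)
  fix i
  assume "i < l"
  have "x (int j + int i) = y (int j + int i)" if "j < d" for j
  proof -
    have "j + i < l + d" using that \<open>i < l\<close> by simp
    then have "x (int (j + i)) = y (int (j + i))" using assms(2) unfolding prefix_eq_iff by blast
    then show ?thesis by simp
  qed
  then have "prefix d ((shift_map ^^ i) x) = prefix d ((shift_map ^^ i) y)"
    unfolding prefix_eq_iff shift_map_funpow by blast
  then have "G ((shift_map ^^ i) x) 0 = G ((shift_map ^^ i) y) 0"
    using assms(1) unfolding window_def by blast
  then show "G x (int i) = G y (int i)" by (simp add: window_apply[OF assms(1)])
qed

lemma window_funpow_prefix:
  assumes "window d G" and "prefix (l + t * d) x = prefix (l + t * d) y"
  shows "prefix l ((G ^^ t) x) = prefix l ((G ^^ t) y)"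
  using assms(2)
proof (induction t arbitrary: l)
  case (Suc t)
  from Suc.IH[of "l + d"] Suc.prems have "prefix (l + d) ((G ^^ t) x) = prefix (l + d) ((G ^^ t) y)"
    by (simp add: algebra_simps)
  from window_prefix[OF assms(1) this] show ?case by simp
qed simp

text \<open>Each step may spoil the last \<open>d\<close> digits, whose windows extend beyond position \<open>L\<close>.\<close>

lemma conf_step_funpow:
  assumes "window d G" and "l + t * d \<le> L"
  shows "prefix l (conf ((step G d L ^^ t) w)) = prefix l ((G ^^ t) (conf w))"
  using assms(2)
proof (induction t arbitrary: l)
  case (Suc t)
  let ?v = "(step G d L ^^ t) w"
  have "prefix (l + d) (conf ?v) = prefix (l + d) ((G ^^ t) (conf w))"
    using Suc.prems by (intro Suc.IH) simp
  then have "prefix l (G (conf ?v)) = prefix l (G ((G ^^ t) (conf w)))"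
    by (rule window_prefix[OF assms(1)])
  moreover have "prefix l (conf (step G d L ?v)) = prefix l (G (conf ?v))"
    using Suc.prems by (simp add: prefix_eq_iff conf_step[OF assms(1)])
  ultimately show ?case by simp
qed simp
text \<open>\<open>G\<close> is consulted only through the table \<open>T\<close> of its values at 0
  on \<open>CARD('a) ^ d\<close> configurations; all else is digit arithmetic and iteration.\<close>

lemma computable_fun_step_funpow:
  fixes G :: "(int \<Rightarrow> 'a::finite) \<Rightarrow> (int \<Rightarrow> 'a)"
  assumes "computable_fun k L" and "computable_fun k w" and "computable_fun k t"
  shows "computable_fun k (\<lambda>xs. (step G d (L xs) ^^ t xs) (w xs))"
proof (rule computable_fun_cong)
  have step: "computable_fun l (\<lambda>xs. step G d (a xs) (b xs))"
    if "computable_fun l a" and "computable_fun l b" for l a b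
    unfolding step_def
    by (intro computable_intros that that[THEN computable_fun_drop]
        computable_fun_table_mod[where T = "\<lambda>j. letter_index (G (conf j) 0)"]) simp_all
  show "computable_fun k (\<lambda>xs. rec_nat (w xs) (\<lambda>m y. step G d (L xs) y) (t xs))"
    by (intro computable_fun_rec step computable_intros assms[THEN computable_fun_drop] assms) simp
  have "rec_nat v (\<lambda>m y. f y) n = (f ^^ n) v" for f and v n :: nat
    by (induction n) simp_all
  then show "rec_nat (w xs) (\<lambda>m y. step G d (L xs) y) (t xs) = (step G d (L xs) ^^ t xs) (w xs)" for xs .
qed

section \<open>Locality of cellular automata\<close>

text \<open>A basic open set of the product restricts finitely many coordinates, and these lie in
  some interval around 0.\<close>

lemma open_fun_contains_window:
  fixes U :: "(int \<Rightarrow> 'a::topological_space) set"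
  assumes "open U" and "x \<in> U"
  shows "\<exists>r. \<forall>y. (\<forall>i. \<bar>i\<bar> \<le> int r \<longrightarrow> y i = x i) \<longrightarrow> y \<in> U"
proof -
  obtain X where X: "x \<in> (\<Pi>\<^sub>E i\<in>UNIV. X i)" "finite {i. X i \<noteq> UNIV}" "(\<Pi>\<^sub>E i\<in>UNIV. X i) \<subseteq> U"
    using product_topology_open_contains_basis[OF assms(1)[unfolded open_fun_def] assms(2)] by auto
  obtain r where r: "\<And>i. X i \<noteq> UNIV \<Longrightarrow> \<bar>i\<bar> \<le> int r"
  proof -
    have "finite ((\<lambda>i. nat \<bar>i\<bar>) ` {i. X i \<noteq> UNIV})" using X(2) by simp
    then obtain r where "\<forall>n\<in>(\<lambda>i. nat \<bar>i\<bar>) ` {i. X i \<noteq> UNIV}. n \<le> r"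
      unfolding finite_nat_set_iff_bounded_le by blast
    then show thesis by (intro that[of r]) (force simp: nat_le_iff)
  qed
  have "y \<in> U" if "\<forall>i. \<bar>i\<bar> \<le> int r \<longrightarrow> y i = x i" for y
  proof -
    have "y i \<in> X i" for i using X(1) that r[of i] by (cases "X i = UNIV") (auto simp: PiE_iff)
    then show ?thesis using X(3) by (auto simp: PiE_iff)
  qed
  then show ?thesis by blast
qed

lemma open_agree:
  fixes x :: "int \<Rightarrow> 'a::discrete_topology"
  assumes "finite I"
  shows "open {y. \<forall>i\<in>I. y i = x i}"
proof -
  have "{y. \<forall>i\<in>I. y i = x i} = (\<Inter>i\<in>I. (\<lambda>y. y i) -` {x i})" by auto
  moreover have "open ((\<lambda>y. y i) -` {x i})" for i
    by (intro open_vimage open_discrete continuous_on_product_coordinates)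
  ultimately show ?thesis using assms by auto
qed

lemma compact_UNIV_configurations: "compact (UNIV :: (int \<Rightarrow> 'a::{finite, topological_space}) set)"
proof -
  have "compact_space (product_topology (\<lambda>i::int. euclidean :: 'a topology) UNIV)"
    using finite_imp_compact[of "UNIV :: 'a set"]
    by (intro compact_space_product_topology[THEN iffD2] disjI2 ballI) (simp add: compact_space_def)
  then show ?thesis unfolding euclidean_product_topology by (simp add: compact_space_def)
qed

text \<open>The locality half of the Curtis-Hedlund-Lyndon theorem: continuity gives a radius at
  each point, and compactness makes it uniform.\<close>

lemma cellular_automaton_radius:
  fixes F :: "(int \<Rightarrow> 'a::{finite, discrete_topology}) \<Rightarrow> (int \<Rightarrow> 'a)"
  assumes "cellular_automaton F"
  shows "\<exists>r. \<forall>x y. (\<forall>i. \<bar>i\<bar> \<le> int r \<longrightarrow> x i = y i) \<longrightarrow> F x 0 = F y 0"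
proof -
  have cont: "continuous_on UNIV (\<lambda>x. F x 0)"
    using assms continuous_on_product_then_coordinatewise[of UNIV F 0]
    by (simp add: cellular_automaton_def)
  have "\<exists>r. \<forall>y. (\<forall>i. \<bar>i\<bar> \<le> int r \<longrightarrow> y i = x i) \<longrightarrow> F y 0 = F x 0" for x
  proof -
    have "open ((\<lambda>y. F y 0) -` {F x 0})" by (intro open_vimage open_discrete cont)
    from open_fun_contains_window[OF this] show ?thesis by auto
  qed
  then obtain r where r: "\<And>x y. (\<forall>i. \<bar>i\<bar> \<le> int (r x) \<longrightarrow> y i = x i) \<Longrightarrow> F y 0 = F x 0" by metis
  define N where "N x = {y. \<forall>i\<in>{- int (r x)..int (r x)}. y i = x i}" for x
  obtain C where C: "finite C" "UNIV \<subseteq> (\<Union>x\<in>C. N x)"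
  proof (rule compactE_image[OF compact_UNIV_configurations, of UNIV N])
    show "open (N x)" for x unfolding N_def by (rule open_agree) simp
  qed (auto simp: N_def)
  have "F y 0 = F z 0" if yz: "\<forall>i. \<bar>i\<bar> \<le> int (Max (r ` C)) \<longrightarrow> y i = z i" for y z
  proof -
    \<comment> \<open>Both \<open>y\<close> and \<open>z\<close> are compared with the centre
      \<open>x\<close> of a member of the finite cover that contains \<open>y\<close>.\<close>
    obtain x where x: "x \<in> C" "y \<in> N x" using C(2) by auto
    have "r x \<le> Max (r ` C)" using C(1) x(1) by simp
    then have "\<forall>i. \<bar>i\<bar> \<le> int (r x) \<longrightarrow> z i = x i \<and> y i = x i"
      using x(2) yz by (auto simp: N_def abs_le_iff)
    then show ?thesis using r[of x y] r[of x z] by simp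
  qed
  then show ?thesis by blast
qed

text \<open>Composing with a power of the shift makes the local rule look to the right only.\<close>

lemma cellular_automaton_window:
  fixes F :: "(int \<Rightarrow> 'a::{finite, discrete_topology}) \<Rightarrow> (int \<Rightarrow> 'a)"
  assumes "cellular_automaton F"
  shows "\<exists>r d. window d ((shift_map ^^ r) \<circ> F)"
proof -
  obtain r where r: "\<And>x y. (\<forall>i. \<bar>i\<bar> \<le> int r \<longrightarrow> x i = y i) \<Longrightarrow> F x 0 = F y 0"
    using cellular_automaton_radius[OF assms] by blast
  have comm: "F \<circ> shift_map = shift_map \<circ> F" using assms by (simp add: cellular_automaton_def)
  let ?G = "(shift_map ^^ r) \<circ> F"
  \<comment> \<open>The shift moves the symmetric window from \<open>-r\<close> to \<open>r\<close>
    onto the positions \<open>0\<close> to \<open>2 * r\<close>, hence the length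
    \<open>2 * r + 1\<close>.\<close>
  have "?G x 0 = ?G y 0" if xy: "prefix (2 * r + 1) x = prefix (2 * r + 1) y" for x y
  proof -
    have "x (i + int r) = y (i + int r)" if "\<bar>i\<bar> \<le> int r" for i
    proof -
      have "nat (i + int r) < 2 * r + 1" and "0 \<le> i + int r" using that by auto
      then show ?thesis using xy unfolding prefix_eq_iff by (metis int_nat_eq)
    qed
    then have "F ((shift_map ^^ r) x) 0 = F ((shift_map ^^ r) y) 0"
      by (intro r) (simp add: shift_map_funpow)
    then show ?thesis by (simp add: commute_shift_map_funpow[OF comm])
  qed
  moreover have "?G \<circ> shift_map = shift_map \<circ> ?G"
  proof
    fix x
    show "(?G \<circ> shift_map) x = (shift_map \<circ> ?G) x"
      using fun_cong[OF comm, of x] by (simp add: funpow_swap1)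
  qed
  ultimately show ?thesis unfolding window_def by blast
qed

section \<open>Measures of preimages of cylinders\<close>

lemma borel_measurable_shift_map:
  "shift_map \<in> borel_measurable (borel :: (int \<Rightarrow> 'a::topological_space) measure)"
  unfolding shift_map_def
  by (intro borel_measurable_continuous_onI continuous_on_coordinatewise_then_product
      continuous_on_product_coordinates)

lemma borel_measurable_funpow:
  fixes f :: "'a::topological_space \<Rightarrow> 'a"
  assumes "f \<in> borel_measurable borel"
  shows "f ^^ n \<in> borel_measurable borel"
proof (induction n)
  case (Suc n)
  show ?case unfolding funpow.simps by (rule measurable_comp[OF Suc assms])
qed (simp add: id_def)

lemma pushforward_pushforward:
  assumes "sets m = sets borel" and "f \<in> borel_measurable borel" and "g \<in> borel_measurable borel"
  shows "pushforward g (pushforward f m) = pushforward (g \<circ> f) m"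
  unfolding pushforward_def using assms
  by (intro distr_distr) (simp_all cong: measurable_cong_sets)

lemma sets_pushforward [simp]: "sets (pushforward f m) = sets borel"
  by (simp add: pushforward_def)

lemma pushforward_id: "sets m = sets borel \<Longrightarrow> pushforward (\<lambda>x. x) m = m"
  unfolding pushforward_def by (rule distr_id2) simp

lemma pushforward_funpow:
  assumes "sets m = sets borel" and "f \<in> borel_measurable borel"
  shows "(pushforward f ^^ n) m = pushforward (f ^^ n) m"
proof (induction n)
  case 0
  then show ?case using assms(1) by (simp add: pushforward_id id_def)
next
  case (Suc n)
  then show ?case
    using pushforward_pushforward[OF assms(1) borel_measurable_funpow[OF assms(2)] assms(2), of n]
    by (simp add: comp_def)
qed

lemma pushforward_mem_invariant_measures:
  assumes "m \<in> invariant_measures" and "f \<in> borel_measurable borel"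
    and "f \<circ> shift_map = shift_map \<circ> f"
  shows "pushforward f m \<in> invariant_measures"
proof -
  have m: "prob_space m" "sets m = sets borel" "pushforward shift_map m = m"
    using assms(1) by (auto simp: invariant_measures_def)
  have "f \<in> measurable m borel" using assms(2) m(2) by (simp cong: measurable_cong_sets)
  then have "prob_space (pushforward f m)"
    unfolding pushforward_def by (rule prob_space.prob_space_distr[OF m(1)])
  moreover have "pushforward shift_map (pushforward f m) = pushforward f (pushforward shift_map m)"
    unfolding pushforward_pushforward[OF m(2) assms(2) borel_measurable_shift_map]
      pushforward_pushforward[OF m(2) borel_measurable_shift_map assms(2)] assms(3) ..
  ultimately show ?thesis using m(3) by (simp add: invariant_measures_def)
qed

text \<open>The image measure under \<open>f\<close> is again invariant and so absorbs the extra
  shifts. This is what permits replacing \<open>F\<close> by a one-sided map.\<close>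

lemma pushforward_shift_map_comp:
  assumes "m \<in> invariant_measures" and "f \<in> borel_measurable borel"
    and "f \<circ> shift_map = shift_map \<circ> f"
  shows "pushforward ((shift_map ^^ r) \<circ> f) m = pushforward f m"
proof -
  have m: "sets m = sets borel" using assms(1) by (auto simp: invariant_measures_def)
  have "pushforward f m \<in> invariant_measures"
    by (rule pushforward_mem_invariant_measures[OF assms])
  then have "pushforward shift_map (pushforward f m) = pushforward f m"
    by (simp add: invariant_measures_def)
  then have "(pushforward shift_map ^^ r) (pushforward f m) = pushforward f m"
    by (induction r) simp_all
  then show ?thesis
    unfolding pushforward_funpow[OF sets_pushforward borel_measurable_shift_map]
      pushforward_pushforward[OF m assms(2) borel_measurable_funpow[OF borel_measurable_shift_map]] .
qed

lemma sets_cylinder: "cylinder (u :: 'a::discrete_topology list) \<in> sets borel"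
proof -
  have "cylinder u = {y. \<forall>i\<in>int ` {..<length u}. y i = u ! nat i}"
    by (auto simp: cylinder_def)
  then have "open (cylinder u)" using open_agree[of "int ` {..<length u}" "\<lambda>i. u ! nat i"] by simp
  then show ?thesis by simp
qed

text \<open>By \<open>H\<close> the event depends on the first \<open>L\<close> letters only, so it
  is a finite disjoint union of cylinders of length \<open>L\<close>, one for each index
  \<open>j\<close> whose representative \<open>conf j\<close> satisfies it.\<close>

lemma measure_prefix_preimage:
  fixes m :: "(int \<Rightarrow> 'a::{finite, discrete_topology}) measure"
  assumes m: "prob_space m" "sets m = sets borel"
    and H: "\<And>x y. prefix L x = prefix L y \<Longrightarrow> prefix l (H x) = prefix l (H y)"
  shows "measure m {x. prefix l (H x) = u} = (\<Sum>j<CARD('a) ^ L.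
    if prefix l (H (conf j)) = u then measure m (cylinder (prefix L (conf j))) else 0)"
proof -
  interpret prob_space m by (rule m)
  let ?J = "{j. j < CARD('a) ^ L \<and> prefix l (H (conf j)) = u}"
  let ?A = "\<lambda>j. cylinder (prefix L (conf j :: int \<Rightarrow> 'a))"
  have A: "x \<in> ?A j \<longleftrightarrow> prefix L x = prefix L (conf j)" for x j
    by (simp add: cylinder_eq)
  have "{x. prefix l (H x) = u} = (\<Union>j\<in>?J. ?A j)"
  proof (intro equalityI subsetI)
    fix x
    assume x: "x \<in> {x. prefix l (H x) = u}"
    obtain j where "j < CARD('a) ^ L" "prefix L (conf j) = prefix L x"
      using ex1_conf_prefix[of L x] by blast
    then show "x \<in> (\<Union>j\<in>?J. ?A j)" using x H[of "conf j" x] by (auto simp: A)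
  next
    fix x
    assume "x \<in> (\<Union>j\<in>?J. ?A j)"
    then obtain j where "prefix l (H (conf j)) = u" "prefix L x = prefix L (conf j)" by (auto simp: A)
    then show "x \<in> {x. prefix l (H x) = u}" using H[of x "conf j"] by simp
  qed
  moreover have "disjoint_family_on ?A ?J"
    unfolding disjoint_family_on_def
  proof (intro ballI impI)
    fix i j
    assume "i \<in> ?J" "j \<in> ?J" "i \<noteq> j"
    then have "prefix L (conf i :: int \<Rightarrow> 'a) \<noteq> prefix L (conf j)"
      using ex1_conf_prefix[of L "conf j :: int \<Rightarrow> 'a"] by blast
    then show "?A i \<inter> ?A j = {}" by (auto simp: cylinder_eq)
  qed
  ultimately have "measure m {x. prefix l (H x) = u} = (\<Sum>j\<in>?J. measure m (?A j))"
    by (simp only:) (rule finite_measure_finite_Union, auto simp: m(2) sets_cylinder)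
  also have "\<dots> = (\<Sum>j\<in>{j \<in> {..<CARD('a) ^ L}. prefix l (H (conf j)) = u}. measure m (?A j))"
    by simp
  also have "\<dots> = (\<Sum>j<CARD('a) ^ L. if prefix l (H (conf j)) = u then measure m (?A j) else 0)"
    by (subst sum.inter_filter) simp_all
  finally show ?thesis .
qed

section \<open>Uniform computability of the iterates\<close>

text \<open>The \<open>N\<close> errors add up to at most \<open>N * 2 / 2 ^ M\<close>, and
  \<open>N < 2 ^ N\<close> puts this below half of \<open>1 / 2 ^ n\<close>; this explains the
  choice of \<open>M\<close>.\<close>

lemma dyadic_sum_approx:
  fixes a :: "nat \<Rightarrow> real" and b :: "nat \<Rightarrow> nat" and n N :: nat
  defines "M \<equiv> n + N + 2"
  assumes "\<And>j. j < N \<Longrightarrow> \<bar>a j - real (b j) / 2 ^ M\<bar> \<le> 2 / 2 ^ M"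
  shows "\<bar>(\<Sum>j<N. if P j then a j else 0) - real (\<Sum>j<N. if P j then b j else 0) / real (2 ^ M)\<bar> < 1 / 2 ^ n"
proof -
  have "(\<Sum>j<N. if P j then a j else 0) - real (\<Sum>j<N. if P j then b j else 0) / real (2 ^ M)
      = (\<Sum>j<N. if P j then a j - real (b j) / 2 ^ M else 0)"
    by (auto simp: sum_divide_distrib sum_subtractf[symmetric] intro!: sum.cong)
  also have "\<bar>\<dots>\<bar> \<le> (\<Sum>j<N. 2 / 2 ^ M)"
    by (rule order.trans[OF sum_abs], rule sum_mono) (use assms in auto)
  also have "\<dots> = real N * (2 / 2 ^ M)" by simp
  also have "\<dots> < 2 ^ N * (2 / 2 ^ M)" using of_nat_less_two_power[of N] by (intro mult_strict_right_mono) auto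
  also have "\<dots> < 1 / 2 ^ n" by (simp add: M_def power_add field_simps)
  finally show ?thesis .
qed

lemma uniformly_computable_window:
  fixes G :: "(int \<Rightarrow> 'a::{finite, discrete_topology}) \<Rightarrow> (int \<Rightarrow> 'a)"
  assumes G: "window d G" and "computable_measure \<mu>"
    and inv: "\<And>t. \<mu>s t \<in> invariant_measures"
    and \<mu>s: "\<And>t u. measure (\<mu>s t) (cylinder u) = measure \<mu> {x. prefix (length u) ((G ^^ t) x) = u}"
  shows "uniformly_computable \<mu>s"
proof -
  have "\<mu> \<in> invariant_measures" using assms(2) by (simp add: computable_measure_def)
  then have \<mu>: "prob_space \<mu>" "sets \<mu> = sets borel" by (auto simp: invariant_measures_def)
  obtain f where f: "computable_word_nat f"
    and approx: "\<And>u n. \<bar>measure \<mu> (cylinder u) - real_of_rat (f u n)\<bar> < 1 / 2 ^ n"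
    using assms(2) unfolding computable_measure_def by blast
  obtain p where "\<forall>u n. \<exists>c. rec_eval p [word_code u, n] c \<and> nat_to_rat_surj c = f u n"
    using f unfolding computable_word_nat_def by blast
  \<comment> \<open>\<open>q u n\<close> is the particular name that \<open>p\<close> outputs. Its
    computability is known only through \<open>p\<close>, on codes of words.\<close>
  then obtain q where q: "\<And>u n. rec_eval p [word_code u, n] (q u n)"
    and q_f: "\<And>u n. nat_to_rat_surj (q u n) = f u n" by metis

  define N where "N c t = CARD('a) ^ (length (list_decode c) + t * d)" for c t
  define M where "M c n t = n + N c t + 2" for c n t
  \<comment> \<open>The program holds only the code \<open>c\<close>, so it recovers the length from
    \<open>c\<close> and compares codes in place of words.\<close>
  define S where "S c n t = (\<Sum>j<N c t.
      if word_code (prefix (length (list_decode c))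
          (conf ((step G d (length (list_decode c) + t * d) ^^ t) j) :: int \<Rightarrow> 'a)) = c
      then dyadic_floor (q (prefix (length (list_decode c) + t * d) (conf j)) (M c n t)) (M c n t)
      else 0)" for c n t
  define out where "out c n t = prod_encode (2 * S c n t, 2 * 2 ^ M c n t)" for c n t

  have comp_q: "computable_fun k (\<lambda>xs. q (prefix (a xs) (conf (b xs))) (e xs))"
    if "computable_fun k a" "computable_fun k b" "computable_fun k e" for k a b e
    by (rule computable_fun_program2[where p = p and a = "\<lambda>xs. word_code (prefix (a xs) (conf (b xs) :: int \<Rightarrow> 'a))" and b = e])
      (auto intro: computable_intros that q)
  have "computable_fun 3 (\<lambda>xs. out (xs ! 0) (xs ! 1) (xs ! 2))"
    unfolding out_def S_def M_def N_def
    by (intro computable_intros comp_q computable_fun_step_funpow) simp_all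
  then obtain prog where "\<And>xs. length xs = 3 \<Longrightarrow> rec_eval prog xs (out (xs ! 0) (xs ! 1) (xs ! 2))"
    unfolding computable_fun_def by blast
  from this[of "[_, _, _]"] have prog: "rec_eval prog [c, n, t] (out c n t)" for c n t
    by (simp add: numeral_2_eq_2)

  have "\<bar>measure (\<mu>s t) (cylinder u) - real_of_rat (nat_to_rat_surj (out (word_code u) n t))\<bar> < 1 / 2 ^ n"
    for u n t
  proof -
    let ?c = "word_code u"
    let ?L = "length u + t * d"
    let ?P = "\<lambda>j. prefix (length u) ((G ^^ t) (conf j)) = u"
    \<comment> \<open>The simulation length is exactly \<open>length u + t * d\<close>, so the first
      \<open>length u\<close> digits are still correct after \<open>t\<close> steps; injectivity of
      \<open>word_code\<close> turns the test into \<open>?P\<close>.\<close>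
    have S: "S ?c n t = (\<Sum>j<N ?c t.
        if ?P j then dyadic_floor (q (prefix ?L (conf j)) (M ?c n t)) (M ?c n t) else 0)"
      unfolding S_def length_list_decode_word_code word_code_eq_iff conf_step_funpow[OF G order.refl] ..
    have meas: "measure (\<mu>s t) (cylinder u)
        = (\<Sum>j<N ?c t. if ?P j then measure \<mu> (cylinder (prefix ?L (conf j))) else 0)"
      unfolding \<mu>s N_def length_list_decode_word_code
      by (rule measure_prefix_preimage[OF \<mu>]) (rule window_funpow_prefix[OF G])
    have out: "real_of_rat (nat_to_rat_surj (out ?c n t)) = real (S ?c n t) / real (2 ^ M ?c n t)"
      unfolding out_def by (rule nat_to_rat_surj_prod_encode_double)
    have "\<bar>measure \<mu> (cylinder (prefix ?L (conf j)))
        - real (dyadic_floor (q (prefix ?L (conf j)) (M ?c n t)) (M ?c n t)) / 2 ^ M ?c n t\<bar>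
        \<le> 2 / 2 ^ M ?c n t" for j
      by (rule dyadic_floor_approx) (use approx in \<open>simp_all add: q_f\<close>)
    then show ?thesis
      unfolding meas out S M_def by (intro dyadic_sum_approx) simp
  qed
  moreover have "computable_word_nat_nat (\<lambda>u n t. nat_to_rat_surj (out (word_code (u :: 'a list)) n t))"
    unfolding computable_word_nat_nat_def using prog by blast
  ultimately show ?thesis
    unfolding uniformly_computable_def using inv by blast
qed

theorem proposition3:
  fixes F :: "(int \<Rightarrow> 'a::{finite, discrete_topology}) \<Rightarrow> (int \<Rightarrow> 'a)"
    and \<mu> \<nu> :: "(int \<Rightarrow> 'a) measure"
  assumes "cellular_automaton F"
    and "\<mu> \<in> invariant_measures"
    and "computable_measure \<mu>"
    and "\<nu> \<in> invariant_measures"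
    and "weak_star_tendsto (\<lambda>t. (pushforward F ^^ t) \<mu>) \<nu>"
  shows "limit_computable \<nu>"
proof -
  let ?\<mu>s = "\<lambda>t. (pushforward F ^^ t) \<mu>"
  have comm: "F \<circ> shift_map = shift_map \<circ> F" and F: "F \<in> borel_measurable borel"
    using assms(1) by (auto simp: cellular_automaton_def intro: borel_measurable_continuous_onI)
  have inv: "?\<mu>s t \<in> invariant_measures" for t
    by (induction t) (simp_all add: assms(2) pushforward_mem_invariant_measures F comm)
  obtain r d where window: "window d ((shift_map ^^ r) \<circ> F)"
    using cellular_automaton_window[OF assms(1)] by blast
  define G where "G = (shift_map ^^ r) \<circ> F"
  have G: "G \<in> borel_measurable borel"
    unfolding G_def by (intro measurable_comp[OF F] borel_measurable_funpow borel_measurable_shift_map)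
  have \<mu>: "sets \<mu> = sets borel" using assms(2) by (simp add: invariant_measures_def)
  \<comment> \<open>Each iterate is invariant, so in every single step \<open>F\<close> can be
    exchanged for \<open>G\<close> without changing the measure.\<close>
  have "?\<mu>s t = (pushforward G ^^ t) \<mu>" for t
  proof (induction t)
    case (Suc t)
    then show ?case using pushforward_shift_map_comp[OF inv[of t] F comm, of r, folded G_def] by simp
  qed simp
  then have \<mu>s: "?\<mu>s t = distr \<mu> borel (G ^^ t)" for t
    by (simp add: pushforward_funpow[OF \<mu> G]) (simp add: pushforward_def)
  have "measure (?\<mu>s t) (cylinder u) = measure \<mu> {x. prefix (length u) ((G ^^ t) x) = u}" for t u
  proof -
    have "G ^^ t \<in> measurable \<mu> borel"
      using borel_measurable_funpow[OF G] \<mu> by (simp cong: measurable_cong_sets)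
    moreover have "(G ^^ t) -` cylinder u \<inter> space \<mu> = {x. prefix (length u) ((G ^^ t) x) = u}"
      using sets_eq_imp_space_eq[OF \<mu>] by (auto simp: cylinder_eq)
    ultimately show ?thesis by (simp add: \<mu>s measure_distr sets_cylinder)
  qed
  with window[folded G_def] assms(3) inv have "uniformly_computable ?\<mu>s"
    by (rule uniformly_computable_window)
  then show ?thesis using assms(4,5) unfolding limit_computable_def by blast
qed

end
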